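(* Let $G$ be a finite simple graph on $n$ vertices and $\bar{G}$ its complement. Then $m_G[0,1) \cdot m_{\bar{G}}[0,1) \leq n$.
   Context: For a finite simple undirected graph $G$ on $n$ vertices, its Laplacian matrix is $L_G = D - A$, where $A$ is the adjacency matrix and $D$ is the diagonal matrix of vertex degrees. For a real interval $I$, $m_G(I)$ denotes the number of Laplacian eigenvalues of $G$, counted with multiplicity, lying in $I$. *)

theory Defs
  imports "Graph_Theory.Pair_Digraph" "Jordan_Normal_Form.Char_Poly"
begin

text \<open>
  A finite simple undirected graph is a \<^locale>\<open>pair_graph\<close>: finitely many vertices and a
  symmetric, irreflexive arc relation, each edge being represented by its two opposite arcs.
\<close>

definition graph_complement :: "'a pair_pre_digraph \<Rightarrow> 'a pair_pre_digraph" where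
  "graph_complement G =
     \<lparr>pverts = pverts G,
      parcs = {(u, v). u \<in> pverts G \<and> v \<in> pverts G \<and> u \<noteq> v \<and> (u, v) \<notin> parcs G}\<rparr>"

text \<open>
  Matrices are indexed by natural numbers, so the graph matrices are taken with respect to a list
  enumerating the vertices without repetition.
\<close>

definition enumerates_verts :: "'a list \<Rightarrow> 'a pair_pre_digraph \<Rightarrow> bool" where
  "enumerates_verts vs G \<longleftrightarrow> distinct vs \<and> set vs = pverts G"

definition adjacency_mat :: "'a list \<Rightarrow> 'a pair_pre_digraph \<Rightarrow> real mat" where
  "adjacency_mat vs G =
     mat (length vs) (length vs) (\<lambda>(i, j). if (vs ! i, vs ! j) \<in> parcs G then 1 else 0)"

text \<open>In a symmetric loop-free graph the degree of a vertex is its out-degree.\<close>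

definition degree_mat :: "'a list \<Rightarrow> 'a pair_pre_digraph \<Rightarrow> real mat" where
  "degree_mat vs G =
     mat (length vs) (length vs)
       (\<lambda>(i, j). if i = j then real (out_degree (with_proj G) (vs ! i)) else 0)"

definition laplacian_mat :: "'a list \<Rightarrow> 'a pair_pre_digraph \<Rightarrow> real mat" where
  "laplacian_mat vs G = degree_mat vs G - adjacency_mat vs G"

definition vertex_list :: "'a pair_pre_digraph \<Rightarrow> 'a list" where
  "vertex_list G = (SOME vs. enumerates_verts vs G)"

text \<open>
  The number of eigenvalues in \<open>I\<close>, each counted with its multiplicity as a root of the
  characteristic polynomial. By \<open>laplacian_count_eq\<close> below, the chosen enumeration is irrelevant.
\<close>

definition eigenvalue_count :: "real mat \<Rightarrow> real set \<Rightarrow> nat" where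
  "eigenvalue_count A I = (\<Sum>x\<in>{x \<in> I. eigenvalue A x}. Polynomial.order x (char_poly A))"

definition laplacian_count :: "'a pair_pre_digraph \<Rightarrow> real set \<Rightarrow> nat" where
  "laplacian_count G I = eigenvalue_count (laplacian_mat (vertex_list G) G) I"

lemma pair_graph_complement:
  assumes "pair_graph G"
  shows "pair_graph (graph_complement G)"
proof -
  interpret pair_graph G by fact
  have sym: "sym (parcs G)"
    using pair_sym_arcs by (simp add: symmetric_def)
  have "finite (pverts G \<times> pverts G)"
    using pair_finite_verts by simp
  then have "finite {(u, v). u \<in> pverts G \<and> v \<in> pverts G \<and> u \<noteq> v \<and> (u, v) \<notin> parcs G}"
    by (rule rev_finite_subset) auto
  then show ?thesis
    using pair_finite_verts sym
    by unfold_locales (auto simp: graph_complement_def symmetric_def intro!: symI dest: symD)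
qed

lemma enumerates_verts_vertex_list:
  assumes "finite (pverts G)"
  shows "enumerates_verts (vertex_list G) G"
  using finite_distinct_list[OF assms]
  unfolding vertex_list_def enumerates_verts_def by (rule_tac someI_ex) blast

lemma laplacian_mat_carrier [simp]:
  "laplacian_mat vs G \<in> carrier_mat (length vs) (length vs)"
  unfolding laplacian_mat_def adjacency_mat_def degree_mat_def
  by (intro minus_carrier_mat mat_carrier)

lemma laplacian_mat_index:
  assumes "i < length vs" "j < length vs"
  shows "laplacian_mat vs G $$ (i, j) =
    (if i = j then real (out_degree (with_proj G) (vs ! i)) else 0)
    - (if (vs ! i, vs ! j) \<in> parcs G then 1 else 0)"
  using assms by (simp add: laplacian_mat_def adjacency_mat_def degree_mat_def)

lemma det_permute_both:
  fixes A :: "'b :: comm_ring_1 mat"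
  assumes A: "A \<in> carrier_mat n n" and p: "p permutes {0..<n}"
  shows "det (mat n n (\<lambda>(i, j). A $$ (p i, p j))) = det A"
proof -
  have lt: "p i < n" if "i < n" for i
    using permutes_in_image[OF p, of i] that by simp
  define B where "B = mat n n (\<lambda>(i, j). A $$ (p i, j))"
  have B: "B \<in> carrier_mat n n" by (simp add: B_def)
  have "mat n n (\<lambda>(i, j). A $$ (p i, p j)) =
      transpose_mat (mat n n (\<lambda>(i, j). transpose_mat B $$ (p i, j)))"
    by (rule eq_matI) (auto simp: B_def lt)
  also have "det \<dots> = det (mat n n (\<lambda>(i, j). transpose_mat B $$ (p i, j)))"
    by (rule det_transpose[of _ n]) simp
  also have "\<dots> = signof p * det (transpose_mat B)"
    by (rule det_permute_rows[OF _ p]) (use B in simp)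
  also have "det (transpose_mat B) = det B"
    by (rule det_transpose[OF B])
  also have "det B = signof p * det A"
    unfolding B_def by (rule det_permute_rows[OF A p])
  finally show ?thesis
    by (simp add: sign_def)
qed

lemma char_poly_laplacian_mat_enumeration:
  assumes "enumerates_verts vs G" "enumerates_verts ws G"
  shows "char_poly (laplacian_mat vs G) = char_poly (laplacian_mat ws G)"
proof -
  have "mset vs = mset ws"
    using assms by (simp add: enumerates_verts_def set_eq_iff_mset_eq_distinct[symmetric])
  then obtain p where p: "p permutes {..<length ws}" and ps: "permute_list p ws = vs"
    by (rule mset_eq_permutation)
  define n where "n = length ws"
  have n: "length vs = n" using ps by (auto simp: n_def)
  have p': "p permutes {0..<n}" using p by (simp add: n_def atLeast0LessThan)
  have lt: "p i < n" if "i < n" for i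
    using permutes_in_image[OF p', of i] that by simp
  have nth: "vs ! i = ws ! p i" if "i < n" for i
    using permute_list_nth[OF p, of i] that ps by (simp add: n_def)
  have inj: "p i = p j \<longleftrightarrow> i = j" for i j
    using permutes_inj[OF p'] by (auto dest: injD)
  let ?L = "char_poly_matrix (laplacian_mat ws G)"
  have L: "laplacian_mat ws G \<in> carrier_mat n n" "laplacian_mat vs G \<in> carrier_mat n n"
    using laplacian_mat_carrier[of ws G] laplacian_mat_carrier[of vs G]
    by (simp_all add: n_def n[unfolded n_def])
  have "char_poly_matrix (laplacian_mat vs G) = mat n n (\<lambda>(i, j). ?L $$ (p i, p j))"
    using L n by (intro eq_matI)
      (auto simp: char_poly_matrix_def laplacian_mat_index lt nth inj n_def[symmetric])
  then show ?thesis
    using det_permute_both[OF char_poly_matrix_closed[OF L(1)] p'] by (simp add: char_poly_def)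
qed

lemma laplacian_count_eq:
  assumes "enumerates_verts vs G"
  shows "laplacian_count G I = eigenvalue_count (laplacian_mat vs G) I"
proof -
  have "finite (pverts G)"
    using assms finite_set[of vs] by (simp add: enumerates_verts_def)
  note e = char_poly_laplacian_mat_enumeration[OF enumerates_verts_vertex_list[OF this] assms]
  have "eigenvalue (laplacian_mat (vertex_list G) G) x \<longleftrightarrow> eigenvalue (laplacian_mat vs G) x" for x
    using eigenvalue_root_char_poly[OF laplacian_mat_carrier] e by metis
  then show ?thesis
    by (simp add: laplacian_count_def eigenvalue_count_def e)
qed

end

theory Submission
  imports Defs
begin

text \<open>
  Let \<open>D\<close> be a dominating set. On a vector vanishing on \<open>D\<close>, the edges joining the remaining vertices
  to \<open>D\<close> alone make the Laplacian form at least the squared norm. The eigenvectors for eigenvalues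
  below 1 span a space on which the form is smaller than the squared norm, so that space meets the
  vectors vanishing on \<open>D\<close> only in 0 and has dimension at most \<open>|D|\<close>. Hence the two eigenvalue counts
  are bounded by the domination numbers of the graph and its complement, whose product is at most
  \<open>n\<close> by a theorem of Jaeger and Payan.
\<close>

subsection \<open>The spectral theorem for real symmetric matrices\<close>

text \<open>Over the complex numbers the characteristic polynomial has a root z. For an eigenvector
  v of z the number v* A v equals z times the squared norm of v, and it is real because A is real
  and symmetric; so z is real and is a root of the real polynomial as well.\<close>

lemma eigenvalue_symmetric_real_exists:
  fixes A :: "real mat"
  assumes A: "A \<in> carrier_mat n n" and sym: "A\<^sup>T = A" and n: "n > 0"
  shows "\<exists>e. eigenvalue A e"
proof -
  define B where "B = map_mat complex_of_real A"
  have B: "B \<in> carrier_mat n n" using A by (simp add: B_def)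
  have "degree (char_poly B) = n" using degree_monic_char_poly[OF B] by simp
  then obtain z where "poly (char_poly B) z = 0"
    using fundamental_theorem_of_algebra[of "char_poly B"] n constant_degree[of "char_poly B"]
    by auto
  then have "eigenvalue B z" using eigenvalue_root_char_poly[OF B] by simp
  then obtain v where v: "v \<in> carrier_vec n" "v \<noteq> 0\<^sub>v n" and ev: "B *\<^sub>v v = z \<cdot>\<^sub>v v"
    using B by (auto simp: eigenvalue_def eigenvector_def)
  have Bv: "(\<Sum>j<n. complex_of_real (A $$ (i,j)) * v $ j) = z * v $ i" if "i < n" for i
  proof -
    have "(B *\<^sub>v v) $ i = (\<Sum>j<n. complex_of_real (A $$ (i,j)) * v $ j)"
      using that A v by (simp add: B_def scalar_prod_def atLeast0LessThan)
    then show ?thesis using ev that v by simp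
  qed
  have As: "A $$ (i,j) = A $$ (j,i)" if "i < n" "j < n" for i j
    using sym A that by (metis carrier_matD index_transpose_mat(1))
  define q where "q = (\<Sum>i<n. \<Sum>j<n. cnj (v $ i) * (complex_of_real (A $$ (i,j)) * v $ j))"
  define s where "s = (\<Sum>i<n. (cmod (v $ i))\<^sup>2)"
  have "q = (\<Sum>i<n. cnj (v $ i) * (z * v $ i))"
    unfolding q_def by (intro sum.cong refl) (simp add: Bv flip: sum_distrib_left)
  also have "\<dots> = z * complex_of_real s"
    unfolding s_def of_real_sum sum_distrib_left
    by (intro sum.cong refl) (simp add: complex_norm_square mult_ac del: of_real_power)
  finally have q: "q = z * complex_of_real s" .
  \<comment> \<open>Conjugation exchanges the roles of i and j; swapping the sums and using the
    symmetry of A gives back \<open>q\<close>.\<close>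
  have "cnj q = (\<Sum>i<n. \<Sum>j<n. cnj (v $ j) * (complex_of_real (A $$ (i,j)) * v $ i))"
    by (simp add: q_def mult_ac)
  also have "\<dots> = (\<Sum>j<n. \<Sum>i<n. cnj (v $ j) * (complex_of_real (A $$ (i,j)) * v $ i))"
    by (rule sum.swap)
  also have "\<dots> = q" unfolding q_def by (intro sum.cong refl) (simp add: As)
  finally have qr: "cnj q = q" .
  obtain i where i: "i < n" "v $ i \<noteq> 0"
    using v by (metis carrier_vecD eq_vecI index_zero_vec)
  have "(cmod (v $ i))\<^sup>2 \<le> s" unfolding s_def using i by (intro member_le_sum) auto
  then have "s \<noteq> 0" using i by (metis norm_eq_zero power2_less_eq_zero_iff)
  then have "cnj z = z" using qr unfolding q by simp
  then obtain e where e: "z = complex_of_real e" by (metis Reals_cases Reals_cnj_iff)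
  have "char_poly B = map_poly complex_of_real (char_poly A)"
    unfolding B_def by (rule of_real_hom.char_poly_hom[OF A])
  then have "poly (map_poly complex_of_real (char_poly A)) (complex_of_real e) = 0"
    using \<open>poly (char_poly B) z = 0\<close> e by simp
  then have "poly (char_poly A) e = 0" by simp
  then show ?thesis using eigenvalue_root_char_poly[OF A] by blast
qed

text \<open>The Householder reflection H = 1 - (2/c) w w^T with w = v - e_0 and c = w . w exchanges
  v and e_0. It gives an orthogonal matrix with first column v without extending v to an orthonormal
  basis.\<close>

lemma householder_reflection:
  fixes v :: "real vec"
  assumes v: "v \<in> carrier_vec n" and n: "n > 0" and v1: "v \<bullet> v = 1"
  obtains H where "H \<in> carrier_mat n n" "H\<^sup>T = H" "H * H = 1\<^sub>m n" "H *\<^sub>v unit_vec n 0 = v"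
proof
  \<comment> \<open>If \<open>v\<close> is the unit vector itself, then \<open>c = 0\<close>, and division by zero makes \<open>H\<close> the identity.\<close>
  define w where "w = v - unit_vec n 0"
  define c where "c = (\<Sum>k<n. w $ k * w $ k)"
  define H where "H = mat n n (\<lambda>(i,j). (if i = j then 1 else 0) - 2 / c * (w $ i * w $ j))"
  show H: "H \<in> carrier_mat n n" by (simp add: H_def)
  show "H\<^sup>T = H" by (rule eq_matI) (auto simp: H_def)
  have w: "w $ i = v $ i - (if i = 0 then 1 else 0)" if "i < n" for i
    using v that n by (auto simp: w_def unit_vec_def)
  have vv: "(\<Sum>k<n. v $ k * v $ k) = 1"
    using v1 v by (simp add: scalar_prod_def atLeast0LessThan)
  have "c = (\<Sum>k<n. v $ k * v $ k + (if k = 0 then 1 - 2 * v $ k else 0))"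
    unfolding c_def by (intro sum.cong refl) (auto simp: w algebra_simps)
  \<comment> \<open>Since w_0 = v_0 - 1, this says w_0 = -c/2, the value that makes H map e_0 to e_0
    + w = v.\<close>
  then have c: "c = 2 - 2 * v $ 0" using n by (simp add: sum.distrib vv sum.delta)
  show "H * H = 1\<^sub>m n"
  proof (rule eq_matI)
    fix i j assume ij: "i < dim_row (1\<^sub>m n :: real mat)" "j < dim_col (1\<^sub>m n :: real mat)"
    have "(H * H) $$ (i,j) = (\<Sum>k<n. H $$ (i,k) * H $$ (k,j))"
      using ij H by (simp add: scalar_prod_def atLeast0LessThan)
    \<comment> \<open>The product of the two entries is expanded so that each Kronecker delta
      selects a single k, while the remaining term sums w_k^2 to c.\<close>
    also have "\<dots> = (\<Sum>k<n. (if k = i then (if i = j then 1 else 0) - 2 / c * (w $ i * w $ j) else 0)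
        - (if k = j then 2 / c * (w $ i * w $ j) else 0)
        + (2 / c)\<^sup>2 * (w $ i * w $ j) * (w $ k * w $ k))"
      using ij by (intro sum.cong refl) (auto simp: H_def algebra_simps power2_eq_square)
    also have "\<dots> = (if i = j then 1 else 0) - 4 / c * (w $ i * w $ j)
        + (2 / c)\<^sup>2 * (w $ i * w $ j) * c"
      using ij by (simp add: sum.distrib sum_subtractf c_def[symmetric] flip: sum_distrib_left)
    also have "\<dots> = (if i = j then 1 else 0)"
      by (cases "c = 0") (auto simp: field_simps power2_eq_square)
    finally show "(H * H) $$ (i,j) = 1\<^sub>m n $$ (i,j)" using ij by simp
  qed (use H in auto)
  show "H *\<^sub>v unit_vec n 0 = v"
  proof (rule eq_vecI)
    fix i assume "i < dim_vec v"
    then have i: "i < n" using v by simp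
    have "(H *\<^sub>v unit_vec n 0) $ i = (if i = 0 then 1 else 0) - 2 / c * (w $ i * w $ 0)"
      using i n H by (simp add: scalar_prod_right_unit) (simp add: H_def)
    also have "\<dots> = v $ i"
    proof (cases "c = 0")
      case True
      then have "w $ i * w $ i = 0"
        using i unfolding c_def by (subst (asm) sum_nonneg_eq_0_iff) auto
      then show ?thesis using True w[OF i] by simp
    next
      case False
      have "w $ 0 = - c / 2" using w[OF n] c by simp
      then have "2 / c * (w $ i * w $ 0) = - w $ i" using False by simp
      then show ?thesis using w[OF i] by simp
    qed
    finally show "(H *\<^sub>v unit_vec n 0) $ i = v $ i" .
  qed (use H v in auto)
qed

text \<open>Induction on the dimension: a reflection taking a unit eigenvector to e_0 splits off a
  1x1 block, and the induction hypothesis diagonalises the rest. Taking \<open>U\<^sup>T\<close> as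
  the inverse in the similarity witness records that U is orthogonal.\<close>

theorem symmetric_real_spectral:
  fixes A :: "real mat"
  assumes "A \<in> carrier_mat n n" "A\<^sup>T = A"
  shows "\<exists>U D. similar_mat_wit A D U U\<^sup>T \<and> diagonal_mat D"
  using assms
proof (induction n arbitrary: A)
  case 0
  then have "similar_mat_wit A A (1\<^sub>m 0) (1\<^sub>m 0)\<^sup>T"
    by (simp add: similar_mat_wit_refl)
  moreover have "diagonal_mat A" using 0 by (simp add: diagonal_mat_def)
  ultimately show ?case by blast
next
  case (Suc n)
  note A = Suc.prems(1)
  obtain e u where u: "u \<in> carrier_vec (Suc n)" "u \<noteq> 0\<^sub>v (Suc n)" and Au: "A *\<^sub>v u = e \<cdot>\<^sub>v u"
    using eigenvalue_symmetric_real_exists[OF Suc.prems] A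
    by (auto simp: eigenvalue_def eigenvector_def)
  have "u \<bullet> u > 0" using conjugate_square_greater_0_vec[OF u(1)] u(2) by simp
  define v where "v = (1 / sqrt (u \<bullet> u)) \<cdot>\<^sub>v u"
  have v: "v \<in> carrier_vec (Suc n)" using u by (simp add: v_def)
  have "v \<bullet> v = (1 / sqrt (u \<bullet> u)) * (1 / sqrt (u \<bullet> u)) * (u \<bullet> u)"
    using u by (simp add: v_def)
  also have "\<dots> = 1" using \<open>u \<bullet> u > 0\<close> by simp
  finally have vv: "v \<bullet> v = 1" .
  have Av: "A *\<^sub>v v = e \<cdot>\<^sub>v v"
    unfolding v_def using mult_mat_vec[OF A u(1)] Au by (simp add: smult_smult_assoc mult.commute)
  obtain H where H: "H \<in> carrier_mat (Suc n) (Suc n)" "H\<^sup>T = H" "H * H = 1\<^sub>m (Suc n)"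
    and Hv: "H *\<^sub>v unit_vec (Suc n) 0 = v"
    using householder_reflection[OF v _ vv] by blast
  let ?e = "unit_vec (Suc n) 0 :: real vec"
  \<comment> \<open>As H exchanges v and e_0, the vector e_0 is an eigenvector of B. This determines
    the first column of B and, by symmetry, its first row.\<close>
  define B where "B = H * A * H"
  have B: "B \<in> carrier_mat (Suc n) (Suc n)" using H A by (simp add: B_def)
  have BT: "B\<^sup>T = B"
    unfolding B_def using H A Suc.prems(2)
    by (simp add: transpose_mult[of _ "Suc n" "Suc n" _ "Suc n"]
        assoc_mult_mat[of _ "Suc n" "Suc n" _ "Suc n" _ "Suc n"])
  have "H *\<^sub>v v = H * H *\<^sub>v ?e"
    unfolding Hv[symmetric] using assoc_mult_mat_vec[OF H(1) H(1), of ?e] by simp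
  then have Hv': "H *\<^sub>v v = ?e" unfolding H(3) by simp
  have "B *\<^sub>v ?e = H *\<^sub>v (A *\<^sub>v (H *\<^sub>v ?e))" unfolding B_def using H A
    by (simp add: assoc_mult_mat_vec[of _ "Suc n" "Suc n" _ "Suc n"])
  then have Be: "B *\<^sub>v ?e = e \<cdot>\<^sub>v ?e" using Hv Hv' Av mult_mat_vec[OF H(1) v] by simp
  have B0: "B $$ (i,0) = (if i = 0 then e else 0)" if "i < Suc n" for i
  proof -
    have "(B *\<^sub>v ?e) $ i = B $$ (i,0)" using B that by (simp add: scalar_prod_right_unit)
    moreover have "(B *\<^sub>v ?e) $ i = (if i = 0 then e else 0)" using Be that by simp
    ultimately show ?thesis by simp
  qed
  have B0': "B $$ (0,i) = (if i = 0 then e else 0)" if "i < Suc n" for i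
    using B0[OF that] BT B that by (metis carrier_matD index_transpose_mat(1) zero_less_Suc)
  define E where "E = mat 1 1 (\<lambda>_. e)"
  define C where "C = mat n n (\<lambda>(i,j). B $$ (Suc i, Suc j))"
  have C: "C \<in> carrier_mat n n" by (simp add: C_def)
  have E: "E \<in> carrier_mat 1 1" by (simp add: E_def)
  have "C\<^sup>T = C" unfolding C_def
    by (rule eq_matI; simp) (metis B BT Suc_less_eq carrier_matD index_transpose_mat(1))
  then obtain U D where UD: "similar_mat_wit C D U U\<^sup>T" and D: "diagonal_mat D"
    using Suc.IH[OF C] by blast
  note UDc = similar_mat_witD2[OF C UD]
  define W where "W = four_block_mat (1\<^sub>m 1) (0\<^sub>m 1 n) (0\<^sub>m n 1) U"
  define F where "F = four_block_mat E (0\<^sub>m 1 n) (0\<^sub>m n 1) D"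
  have BE: "B = four_block_mat E (0\<^sub>m 1 n) (0\<^sub>m n 1) C"
    using B B0 B0' by (intro eq_matI) (auto simp: E_def C_def)
  have WT: "W\<^sup>T = four_block_mat (1\<^sub>m 1) (0\<^sub>m 1 n) (0\<^sub>m n 1) U\<^sup>T"
    unfolding W_def using UDc
    by (subst transpose_four_block_mat[of _ 1 1 _ n _ n]) auto
  have "similar_mat_wit B F W W\<^sup>T"
    unfolding WT unfolding W_def BE F_def
    by (rule similar_mat_wit_four_block[OF similar_mat_wit_refl[OF E] UD])
       (use UDc E C in auto)
  moreover have W: "W \<in> carrier_mat (Suc n) (Suc n)"
    using four_block_carrier_mat[of "1\<^sub>m 1" 1 1 U n n] UDc by (simp add: W_def)
  moreover have "similar_mat_wit A B H H"
  proof (rule similar_mat_witI[OF H(3) H(3) _ A B H(1) H(1)])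
    have "H * B * H = (H * H) * A * (H * H)"
      unfolding B_def using H(1) A
      by (simp add: assoc_mult_mat[of _ "Suc n" "Suc n" _ "Suc n" _ "Suc n"])
    then show "A = H * B * H" using H(3) A by simp
  qed
  ultimately have "similar_mat_wit A F (H * W) (W\<^sup>T * H)"
    using similar_mat_wit_trans by blast
  moreover have "W\<^sup>T * H = (H * W)\<^sup>T"
    using H W by (simp add: transpose_mult[of _ "Suc n" "Suc n" _ "Suc n"])
  moreover have "diagonal_mat F"
    using D UDc E by (auto simp: diagonal_mat_def F_def)
  ultimately show ?case by metis
qed

subsection \<open>Counting eigenvalues below a bound\<close>

lemma order_prod_list_linear:
  fixes xs :: "'a :: field list"
  shows "Polynomial.order x (\<Prod>a\<leftarrow>xs. [:- a, 1:]) = count_list xs x"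
proof (induction xs)
  case (Cons a xs)
  have "(\<Prod>a\<leftarrow>xs. [:- a, 1:]) \<noteq> 0"
    by (auto simp: prod_list_zero_iff)
  then have ne: "[:- a, 1:] * (\<Prod>a\<leftarrow>xs. [:- a, 1:]) \<noteq> 0"
    by (intro no_zero_divisors) auto
  have "Polynomial.order x [:- a, 1:] = (if a = x then 1 else 0)"
    using order_power_n_n[of x 1] by (auto intro: order_0I)
  then show ?case using order_mult[OF ne, of x] Cons.IH by simp
qed simp

text \<open>The characteristic polynomial is the product of the linear factors given by the diagonal
  of D, so the multiplicity of a root is the number of its occurrences there. Summing over the roots
  in I groups the diagonal positions by their entry.\<close>

lemma eigenvalue_count_similar_diagonal:
  fixes A :: "real mat"
  assumes sim: "similar_mat_wit A D P Q" and A: "A \<in> carrier_mat n n" and D: "diagonal_mat D"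
  shows "eigenvalue_count A I = card {i. i < n \<and> D $$ (i,i) \<in> I}"
proof -
  have Dc: "D \<in> carrier_mat n n" using similar_mat_witD2[OF A sim] by simp
  have "char_poly A = char_poly D"
    using sim by (intro char_poly_similar) (auto simp: similar_mat_def)
  also have "\<dots> = (\<Prod>a\<leftarrow>diag_mat D. [:- a, 1:])"
    using Dc D by (intro char_poly_upper_triangular) (auto simp: diagonal_mat_def upper_triangular_def)
  finally have cp: "char_poly A = (\<Prod>a\<leftarrow>diag_mat D. [:- a, 1:])" .
  define J where "J = {i. i < n \<and> D $$ (i,i) \<in> I}"
  have diag: "diag_mat D = map (\<lambda>i. D $$ (i,i)) [0..<n]" using Dc by (simp add: diag_mat_def)
  have ev: "eigenvalue A x \<longleftrightarrow> x \<in> (\<lambda>i. D $$ (i,i)) ` {..<n}" for x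
    unfolding eigenvalue_root_char_poly[OF A] cp diag
    by (auto simp: poly_prod_list prod_list_zero_iff)
  have "eigenvalue_count A I = (\<Sum>x\<in>(\<lambda>i. D $$ (i,i)) ` J. count_list (diag_mat D) x)"
    unfolding eigenvalue_count_def cp order_prod_list_linear
    by (rule sum.cong) (auto simp: ev J_def)
  also have "\<dots> = (\<Sum>x\<in>(\<lambda>i. D $$ (i,i)) ` J. \<Sum>i | i \<in> J \<and> D $$ (i,i) = x. 1)"
  proof (rule sum.cong)
    fix x assume "x \<in> (\<lambda>i. D $$ (i,i)) ` J"
    then have "x \<in> I" by (auto simp: J_def)
    have "count_list (diag_mat D) x = card {i. i < length (diag_mat D) \<and> diag_mat D ! i = x}"
      unfolding count_list_eq_length_filter length_filter_conv_card by (simp add: eq_commute)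
    also have "{i. i < length (diag_mat D) \<and> diag_mat D ! i = x} = {i. i \<in> J \<and> D $$ (i,i) = x}"
      using \<open>x \<in> I\<close> by (auto simp: diag J_def)
    finally show "count_list (diag_mat D) x = (\<Sum>i | i \<in> J \<and> D $$ (i,i) = x. 1)" by simp
  qed simp
  also have "\<dots> = card J"
    using sum.group[of J "(\<lambda>i. D $$ (i,i)) ` J" "\<lambda>i. D $$ (i,i)" "\<lambda>_. 1::nat"]
    by (simp add: J_def)
  finally show ?thesis by (simp add: J_def)
qed

text \<open>A homogeneous system with fewer equations than unknowns has a nonzero solution. Padding
  the system with zero rows makes it square and singular, so determinants suffice.\<close>

lemma exists_nonzero_orthogonal:
  fixes ws :: "'a :: field vec list"
  assumes "length ws < n" "set ws \<subseteq> carrier_vec n"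
  obtains v where "v \<in> carrier_vec n" "v \<noteq> 0\<^sub>v n" "\<And>w. w \<in> set ws \<Longrightarrow> w \<bullet> v = 0"
proof -
  define M where "M = mat n n (\<lambda>(i,j). if i < length ws then ws ! i $ j else 0)"
  have M: "M \<in> carrier_mat n n" by (simp add: M_def)
  \<comment> \<open>Row \<open>length ws\<close> is the first padding row; it exists because
    \<open>length ws < n\<close>.\<close>
  have "M\<^sup>T *\<^sub>v unit_vec n (length ws) = 0\<^sub>v n"
    using assms(1) M by (intro eq_vecI) (auto simp: M_def)
  moreover have "unit_vec n (length ws) \<noteq> (0\<^sub>v n :: 'a vec)" using assms(1) by simp
  ultimately have "det M\<^sup>T = 0"
    using det_0_iff_vec_prod_zero_field[of "M\<^sup>T" n] M
    by (meson transpose_carrier_mat unit_vec_carrier)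
  then have "det M = 0" using det_transpose[OF M] by simp
  then obtain v where v: "v \<in> carrier_vec n" "v \<noteq> 0\<^sub>v n" "M *\<^sub>v v = 0\<^sub>v n"
    using det_0_iff_vec_prod_zero_field[OF M] by blast
  have "w \<bullet> v = 0" if w: "w \<in> set ws" for w
  proof -
    obtain i where i: "i < length ws" "w = ws ! i" using w by (auto simp: in_set_conv_nth)
    have "w \<in> carrier_vec n" using w assms(2) by blast
    then have "row M i = w" using i assms(1) by (intro eq_vecI) (auto simp: M_def)
    moreover have "(M *\<^sub>v v) $ i = 0" using v i assms(1) by simp
    ultimately show ?thesis using i assms(1) M by simp
  qed
  then show thesis using that v by blast
qed

text \<open>The vectors vanishing on J form a subspace of codimension |J|. If more than |J|
  eigenvalues lay in I, their eigenvectors would span a space meeting it in some nonzero x, where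
  the form would be both at least and strictly below c (x . x).\<close>

lemma eigenvalue_count_le_codim:
  fixes A :: "real mat"
  assumes A: "A \<in> carrier_mat n n" and sym: "A\<^sup>T = A" and J: "J \<subseteq> {..<n}"
    and form: "\<And>x. x \<in> carrier_vec n \<Longrightarrow> (\<forall>j\<in>J. x $ j = 0) \<Longrightarrow> c * (x \<bullet> x) \<le> x \<bullet> (A *\<^sub>v x)"
    and I: "I \<subseteq> {..<c}"
  shows "eigenvalue_count A I \<le> card J"
proof (rule ccontr)
  assume "\<not> ?thesis"
  then have less: "card J < eigenvalue_count A I" by simp
  obtain U D where UD: "similar_mat_wit A D U U\<^sup>T" and D: "diagonal_mat D"
    using symmetric_real_spectral[OF A sym] by blast
  note w = similar_mat_witD2[OF A UD]
  have U: "U \<in> carrier_mat n n" and Dc: "D \<in> carrier_mat n n" and UU: "U\<^sup>T * U = 1\<^sub>m n"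
    and AUD: "A = U * D * U\<^sup>T" using w by auto
  define S where "S = {i. i < n \<and> D $$ (i,i) \<in> I}"
  have SJ: "card J < card S"
    using less unfolding eigenvalue_count_similar_diagonal[OF UD A D] S_def .
  \<comment> \<open>For coordinates y in the eigenbasis, the rows of U impose that U y vanishes on
    J, and the unit vectors that y is supported on S. These are |J| + n - |S| < n equations.\<close>
  define ws where "ws = map (row U) (sorted_list_of_set J) @ map (unit_vec n) (sorted_list_of_set ({..<n} - S))"
  have fin: "finite J" "finite S" "S \<subseteq> {..<n}" using J finite_subset by (auto simp: S_def)
  have "card S \<le> n" using card_mono[OF _ fin(3)] by simp
  then have "length ws < n"
    using SJ fin by (simp add: ws_def card_Diff_subset)
  moreover have "set ws \<subseteq> carrier_vec n" using U J fin by (auto simp: ws_def)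
  ultimately obtain y where y: "y \<in> carrier_vec n" "y \<noteq> 0\<^sub>v n"
    and orth: "\<And>w. w \<in> set ws \<Longrightarrow> w \<bullet> y = 0"
    using exists_nonzero_orthogonal by blast
  have yS: "y $ i = 0" if "i < n" "i \<notin> S" for i
    using orth[of "unit_vec n i"] that y by (simp add: ws_def)
  define x where "x = U *\<^sub>v y"
  have x: "x \<in> carrier_vec n" using U y by (simp add: x_def)
  have xJ: "\<forall>j\<in>J. x $ j = 0"
    using orth J U fin by (auto simp: x_def ws_def)
  have Ux: "U\<^sup>T *\<^sub>v x = y"
    unfolding x_def using assoc_mult_mat_vec[of "U\<^sup>T" n n U n y] U y UU by simp
  \<comment> \<open>Orthogonality of U lets both x . x and the form be computed in the coordinates
    y, where the form is diagonal.\<close>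
  have dot: "x \<bullet> (U *\<^sub>v z) = y \<bullet> z" if "z \<in> carrier_vec n" for z
    using transpose_vec_mult_scalar[OF U that x] Ux comm_scalar_prod that y U x
    by (metis mult_mat_vec_carrier)
  have Ax: "A *\<^sub>v x = U *\<^sub>v (D *\<^sub>v y)"
    unfolding AUD using U Dc x Ux
    by (simp add: assoc_mult_mat_vec[of _ n n _ n])
  have "x \<bullet> x = y \<bullet> y" using dot[OF y(1)] by (simp add: x_def)
  also have "\<dots> = (\<Sum>i<n. y $ i * y $ i)"
    using y by (simp add: scalar_prod_def atLeast0LessThan)
  finally have xx: "x \<bullet> x = (\<Sum>i<n. y $ i * y $ i)" .
  have Dy: "(D *\<^sub>v y) $ i = D $$ (i,i) * y $ i" if i: "i < n" for i
  proof -
    have "(D *\<^sub>v y) $ i = (\<Sum>j<n. D $$ (i,j) * y $ j)"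
      using i Dc y by (simp add: scalar_prod_def atLeast0LessThan)
    also have "\<dots> = (\<Sum>j<n. if j = i then D $$ (i,i) * y $ i else 0)"
      using D Dc i by (intro sum.cong refl) (auto simp: diagonal_mat_def)
    finally show ?thesis using i by simp
  qed
  have "x \<bullet> (A *\<^sub>v x) = y \<bullet> (D *\<^sub>v y)"
    unfolding Ax using dot Dc y by simp
  also have "\<dots> = (\<Sum>i<n. y $ i * (D $$ (i,i) * y $ i))"
    using y Dc by (simp add: scalar_prod_def atLeast0LessThan Dy del: index_mult_mat_vec)
  \<comment> \<open>Off S both terms are 0, and on S the eigenvalue is below c. A nonzero coordinate
    of y lies in S and makes the inequality strict.\<close>
  also have "\<dots> < (\<Sum>i<n. c * (y $ i * y $ i))"
  proof (rule sum_strict_mono_ex1)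
    have S: "D $$ (i,i) < c" if "i \<in> S" for i using that I by (auto simp: S_def)
    show "\<forall>i\<in>{..<n}. y $ i * (D $$ (i,i) * y $ i) \<le> c * (y $ i * y $ i)"
    proof
      fix i assume i: "i \<in> {..<n}"
      show "y $ i * (D $$ (i,i) * y $ i) \<le> c * (y $ i * y $ i)"
      proof (cases "i \<in> S")
        case True
        then have "D $$ (i,i) * (y $ i * y $ i) \<le> c * (y $ i * y $ i)"
          using S by (intro mult_right_mono) (auto intro: less_imp_le)
        then show ?thesis by (simp add: mult_ac)
      qed (use i yS in simp)
    qed
    obtain i where i: "i < n" "y $ i \<noteq> 0"
      using y by (metis carrier_vecD eq_vecI index_zero_vec)
    then have "i \<in> S" using yS by blast
    have "y $ i * y $ i > 0" using i(2) by (meson not_real_square_gt_zero)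
    then have "D $$ (i,i) * (y $ i * y $ i) < c * (y $ i * y $ i)"
      using S[OF \<open>i \<in> S\<close>] by (intro mult_strict_right_mono)
    then show "\<exists>i\<in>{..<n}. y $ i * (D $$ (i,i) * y $ i) < c * (y $ i * y $ i)"
      using i(1) by (intro bexI[of _ i]) (auto simp: mult_ac)
  qed simp
  also have "\<dots> = c * (x \<bullet> x)" by (simp add: xx sum_distrib_left)
  finally show False using form[OF x xJ] by simp
qed

subsection \<open>Domination in a graph and its complement\<close>

text \<open>Adjacency is an arbitrary relation so that the same notion applies to a graph and to its
  complement.\<close>

definition dominating :: "('a \<Rightarrow> 'a \<Rightarrow> bool) \<Rightarrow> 'a set \<Rightarrow> 'a set \<Rightarrow> bool" where
  "dominating R V D \<longleftrightarrow> D \<subseteq> V \<and> (\<forall>v\<in>V - D. \<exists>d\<in>D. R v d)"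

text \<open>
  Partition the vertices into as many classes as a minimum dominating set \<open>D\<close> has elements, each class
  containing a vertex adjacent to the rest of its class (a central vertex), with as many central
  vertices as possible. Then every class dominates the complement, and the smallest one will do:
  if \<open>x\<close> outside a class is adjacent to the whole class, then either \<open>x\<close> is central, and it can replace
  two members of a dominating set, or moving \<open>x\<close> into that class creates a new central vertex.
\<close>

theorem jaeger_payan:
  assumes V: "finite V" and sym: "\<And>u v. R u v \<Longrightarrow> R v u"
  shows "\<exists>D D'. dominating R V D \<and> dominating (\<lambda>u v. u \<noteq> v \<and> \<not> R u v) V D' \<and>
    card D * card D' \<le> card V"
proof -
  have "dominating R V V" by (simp add: dominating_def)
  then obtain D where D: "dominating R V D" and
    min: "\<And>D'. dominating R V D' \<Longrightarrow> card D \<le> card D'"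
    using ex_has_least_nat[of "dominating R V" V card] by blast
  have DV: "D \<subseteq> V" using D by (simp add: dominating_def)
  have fD: "finite D" using DV V finite_subset by blast
  \<comment> \<open>A partition is encoded by a map \<open>f\<close> into D. In a
    \<open>good\<close> partition the members of D merely label the classes: the central vertex of
    class d may differ from d.\<close>
  define central where "central f v \<longleftrightarrow> v \<in> V \<and> (\<forall>u\<in>V. f v = f u \<longrightarrow> u = v \<or> R u v)" for f :: "'a \<Rightarrow> 'a" and v
  define good where "good f \<longleftrightarrow> f ` V \<subseteq> D \<and> (\<forall>d\<in>D. \<exists>v. central f v \<and> f v = d)" for f
  \<comment> \<open>Each vertex outside D joins the class of a neighbour in D, and each member of D
    is central in its own class.\<close>
  have "\<exists>f. good f"
  proof -
    have "\<forall>v. \<exists>d. v \<in> V \<longrightarrow> d \<in> D \<and> (if v \<in> D then d = v else R v d)"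
      using D by (auto simp: dominating_def)
    then obtain f where f: "\<And>v. v \<in> V \<Longrightarrow> f v \<in> D \<and> (if v \<in> D then f v = v else R v (f v))"
      by metis
    have "central f d \<and> f d = d" if "d \<in> D" for d
    proof (rule conjI)
      have fd: "f d = d" using f[of d] that DV by auto
      then show "f d = d" .
      show "central f d"
        unfolding central_def
      proof (intro conjI ballI impI)
        show "d \<in> V" using that DV by blast
        fix u assume u: "u \<in> V" "f d = f u"
        then show "u = d \<or> R u d" using f[OF u(1)] fd by (cases "u \<in> D") auto
      qed
    qed
    then have "good f" using f by (auto simp: good_def)
    then show ?thesis by blast
  qed
  moreover have "\<forall>f. good f \<longrightarrow> card {v. central f v} \<le> card V"
    using V by (auto intro!: card_mono simp: central_def)
  ultimately obtain f where f: "good f"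
    and max: "\<And>g. good g \<Longrightarrow> card {v. central g v} \<le> card {v. central f v}"
    using ex_has_greatest_nat[of good _ "\<lambda>f. card {v. central f v}" "Suc (card V)"]
    by (metis le_imp_less_Suc)
  have part: "dominating (\<lambda>u v. u \<noteq> v \<and> \<not> R u v) V {v \<in> V. f v = j}" if j: "j \<in> D" for j
  proof (rule ccontr)
    assume "\<not> ?thesis"
    then obtain x where x: "x \<in> V" "f x \<noteq> j" and xj: "\<And>v. v \<in> V \<Longrightarrow> f v = j \<Longrightarrow> R x v"
      by (auto simp: dominating_def)
    have fx: "f x \<in> D" using f x by (auto simp: good_def)
    obtain c where c: "\<And>d. d \<in> D \<Longrightarrow> central f (c d) \<and> f (c d) = d"
      using f unfolding good_def by metis
    show False
    proof (cases "central f x")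
      case True
      \<comment> \<open>The vertex x serves both class j, by its choice, and its own class, being
        central; every other class keeps its central vertex. This saves one vertex against the
        minimum.\<close>
      define D' where "D' = insert x (c ` (D - {j, f x}))"
      have "dominating R V D'"
        unfolding dominating_def
      proof (intro conjI ballI)
        show "D' \<subseteq> V" using c x by (auto simp: D'_def central_def)
        fix v assume v: "v \<in> V - D'"
        then have vD: "f v \<in> D" using f by (auto simp: good_def)
        consider "f v = j" | "f v = f x" | "f v \<in> D - {j, f x}" using vD by blast
        then show "\<exists>d\<in>D'. R v d"
        proof cases
          case 1
          then have "R v x" using xj v by (auto intro: sym)
          then show ?thesis by (auto simp: D'_def)
        next
          case 2
          then show ?thesis using True v by (auto simp: D'_def central_def)
        next
          case 3
          then have "c (f v) \<in> D'" by (simp add: D'_def)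
          moreover have "R v (c (f v))"
            using c[OF vD] v \<open>c (f v) \<in> D'\<close> by (auto simp: central_def)
          ultimately show ?thesis by blast
        qed
      qed
      then have "card D \<le> card D'" by (rule min)
      also have "\<dots> \<le> Suc (card (c ` (D - {j, f x})))"
        unfolding D'_def using fD by (simp add: card_insert_if)
      also have "\<dots> \<le> Suc (card (D - {j, f x}))" using fD by (simp add: card_image_le)
      also have "\<dots> = Suc (card D - 2)" using j fx x(2) fD by (simp add: card_Diff_subset)
      \<comment> \<open>Subtraction is truncated, so the bound gives only this, which the distinct
        members j and \<open>f x\<close> of D refute.\<close>
      finally have "card D \<le> 1" by simp
      then show False using j fx x(2) fD
        by (metis One_nat_def card_le_Suc0_iff_eq)
    next
      case False
      \<comment> \<open>Moving x loses no central vertex: its old class only shrinks, and everything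
        in class j is adjacent to x. For the same reason x becomes central, against the maximality
        of \<open>f\<close>.\<close>
      define g where "g = f(x := j)"
      have cg: "central g v" "g v = f v" if "central f v" for v
      proof -
        have "v \<noteq> x" using that False by auto
        then show "g v = f v" by (simp add: g_def)
        show "central g v"
          using that \<open>v \<noteq> x\<close> xj by (auto simp: central_def g_def)
      qed
      have "good g"
        unfolding good_def
      proof (intro conjI ballI)
        show "g ` V \<subseteq> D" using f j by (auto simp: good_def g_def)
        show "\<exists>v. central g v \<and> g v = d" if "d \<in> D" for d
          using c[OF that] cg by metis
      qed
      have "central g x" using x xj by (auto simp: central_def g_def intro: sym)
      have "finite {v. central g v}" using V by (auto simp: central_def intro: rev_finite_subset)
      moreover have "{v. central f v} \<subset> {v. central g v}"
        using cg \<open>central g x\<close> False by blast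
      ultimately have "card {v. central f v} < card {v. central g v}"
        by (rule psubset_card_mono)
      then show False using max[OF \<open>good g\<close>] by simp
    qed
  qed
  show ?thesis
  proof (cases "D = {}")
    case True
    then show ?thesis using D \<open>dominating R V V\<close>
      by (intro exI[of _ D] exI[of _ V]) (simp add: dominating_def)
  next
    case False
    have "(\<Sum>j\<in>D. card {v \<in> V. f v = j}) = card V"
      using sum.group[OF V fD, of f "\<lambda>_. 1::nat"] f by (simp add: good_def)
    moreover
    define p where "p j = card {v \<in> V. f v = j}" for j
    \<comment> \<open>The smallest of the |D| classes has at most the average size |V| /
      |D|.\<close>
    define j where "j = arg_min_on p D"
    have j: "j \<in> D" and "\<And>i. i \<in> D \<Longrightarrow> p j \<le> p i"
      using arg_min_if_finite[OF fD False, of p] by (auto simp: j_def not_less)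
    then have "card D * p j \<le> (\<Sum>i\<in>D. p i)"
      using sum_bounded_below[of D "p j" p] by simp
    ultimately have "card D * card {v \<in> V. f v = j} \<le> card V" by (simp add: p_def)
    then show ?thesis using D part[OF j] by blast
  qed
qed

subsection \<open>The Laplacian form\<close>

lemma laplacian_transpose:
  assumes "pair_graph G"
  shows "(laplacian_mat vs G)\<^sup>T = laplacian_mat vs G"
proof -
  interpret pair_graph G by fact
  have "(u, v) \<in> parcs G \<longleftrightarrow> (v, u) \<in> parcs G" for u v
    using pair_sym_arcs by (auto simp: symmetric_def dest: symD)
  then show ?thesis
    by (intro eq_matI)
      (auto simp: laplacian_mat_index carrier_matD[OF laplacian_mat_carrier])
qed

text \<open>With the degree written as a row sum of adjacency entries, the diagonal of the Laplacian
  merges with its off-diagonal part into differences x_i - x_j.\<close>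

lemma out_degree_enumeration:
  assumes G: "pair_graph G" and vs: "enumerates_verts vs G"
  shows "real (out_degree (with_proj G) v) =
    (\<Sum>j<length vs. if (v, vs ! j) \<in> parcs G then 1 else 0)"
proof -
  interpret pair_graph G by fact
  have d: "distinct vs" "set vs = pverts G" using vs by (auto simp: enumerates_verts_def)
  let ?J = "{j. j < length vs \<and> (v, vs ! j) \<in> parcs G}"
  have "bij_betw (\<lambda>j. (v, vs ! j)) ?J (out_arcs (with_proj G) v)"
  proof (rule bij_betwI')
    fix e assume "e \<in> out_arcs (with_proj G) v"
    then obtain w where w: "e = (v, w)" "(v, w) \<in> parcs G" by (cases e) (auto simp: out_arcs_def)
    then have "w \<in> set vs" using in_arcsD2 d by simp
    then show "\<exists>j\<in>?J. e = (v, vs ! j)" using w by (auto simp: in_set_conv_nth)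
  next
    fix i j assume "i \<in> ?J" "j \<in> ?J"
    then show "(v, vs ! i) = (v, vs ! j) \<longleftrightarrow> i = j" using d(1) by (simp add: nth_eq_iff_index_eq)
  qed (simp add: out_arcs_def)
  then have "out_degree (with_proj G) v = card ?J"
    by (simp add: out_degree_def bij_betw_same_card)
  moreover have "(\<Sum>j<length vs. if (v, vs ! j) \<in> parcs G then 1 else 0) = real (card ?J)"
    by (simp add: sum.If_cases Int_def)
  ultimately show ?thesis by simp
qed

text \<open>The factor 2 arises because the sum runs over ordered pairs and meets each edge twice.
  The form is added to its copy with i and j exchanged, and x_i (x_i - x_j) + x_j (x_j - x_i) = (x_i
  - x_j)^2.\<close>

lemma laplacian_quadratic_form:
  assumes G: "pair_graph G" and vs: "enumerates_verts vs G" and x: "x \<in> carrier_vec (length vs)"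
  shows "2 * (x \<bullet> (laplacian_mat vs G *\<^sub>v x)) =
    (\<Sum>i<length vs. \<Sum>j<length vs. (if (vs ! i, vs ! j) \<in> parcs G then 1 else 0) * (x $ i - x $ j)\<^sup>2)"
proof -
  interpret pair_graph G by fact
  let ?n = "length vs"
  let ?L = "laplacian_mat vs G"
  define a where "a i j = (if (vs ! i, vs ! j) \<in> parcs G then 1 else 0 :: real)" for i j
  have a_sym: "a i j = a j i" for i j
    using pair_sym_arcs by (auto simp: a_def symmetric_def dest: symD)
  have L: "(?L *\<^sub>v x) $ i = (\<Sum>j<?n. a i j * (x $ i - x $ j))" if i: "i < ?n" for i
  proof -
    have "(?L *\<^sub>v x) $ i = (\<Sum>j<?n. ?L $$ (i,j) * x $ j)"
      using i x
      by (simp add: scalar_prod_def atLeast0LessThan carrier_matD[OF laplacian_mat_carrier])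
    also have "\<dots> = (\<Sum>j<?n. (if j = i then (\<Sum>k<?n. a i k) * x $ i else 0) - a i j * x $ j)"
      using i by (intro sum.cong refl)
        (auto simp: laplacian_mat_index a_def out_degree_enumeration[OF G vs] algebra_simps)
    also have "\<dots> = (\<Sum>j<?n. a i j * (x $ i - x $ j))"
      using i by (simp add: sum_subtractf right_diff_distrib sum_distrib_right)
    finally show ?thesis .
  qed
  have q: "x \<bullet> (?L *\<^sub>v x) = (\<Sum>i<?n. \<Sum>j<?n. a i j * (x $ i * (x $ i - x $ j)))"
    using x
    by (simp add: scalar_prod_def[of x] atLeast0LessThan L sum_distrib_left mult_ac
        carrier_matD[OF laplacian_mat_carrier] del: index_mult_mat_vec)
  also have "\<dots> = (\<Sum>i<?n. \<Sum>j<?n. a i j * (x $ j * (x $ j - x $ i)))"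
    by (subst sum.swap) (simp add: a_sym)
  finally have "2 * (x \<bullet> (?L *\<^sub>v x)) = (\<Sum>i<?n. \<Sum>j<?n. a i j * (x $ i * (x $ i - x $ j)))
      + (\<Sum>i<?n. \<Sum>j<?n. a i j * (x $ j * (x $ j - x $ i)))"
    using q by simp
  also have "\<dots> = (\<Sum>i<?n. \<Sum>j<?n. a i j * (x $ i - x $ j)\<^sup>2)"
    unfolding sum.distrib[symmetric]
    by (intro sum.cong refl) (simp add: power2_eq_square algebra_simps)
  finally show ?thesis by (simp add: a_def)
qed

lemma laplacian_count_le_dominating:
  assumes G: "pair_graph G" and D: "dominating (\<lambda>u v. (u, v) \<in> parcs G) (pverts G) D"
  shows "laplacian_count G {0..<1} \<le> card D"
proof -
  interpret pair_graph G by fact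
  obtain vs where vs: "enumerates_verts vs G"
    using enumerates_verts_vertex_list[OF pair_finite_verts] by blast
  then have d: "distinct vs" "set vs = pverts G" by (auto simp: enumerates_verts_def)
  have DV: "D \<subseteq> pverts G" using D by (simp add: dominating_def)
  let ?n = "length vs"
  define J where "J = {j. j < ?n \<and> vs ! j \<in> D}"
  have "bij_betw (\<lambda>j. vs ! j) J D"
  proof (rule bij_betwI')
    fix v assume v: "v \<in> D"
    then have "v \<in> set vs" using DV d by blast
    then obtain j where "j < ?n" "v = vs ! j" by (auto simp: in_set_conv_nth)
    then show "\<exists>j\<in>J. v = vs ! j" using v by (auto simp: J_def)
  next
    fix i j assume "i \<in> J" "j \<in> J"
    then show "vs ! i = vs ! j \<longleftrightarrow> i = j" using d(1) by (simp add: J_def nth_eq_iff_index_eq)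
  qed (simp add: J_def)
  then have cardJ: "card J = card D" by (rule bij_betw_same_card)
  define a where "a i j = (if (vs ! i, vs ! j) \<in> parcs G then 1 else 0 :: real)" for i j
  have a_sym: "a i j = a j i" for i j
    using pair_sym_arcs by (auto simp: a_def symmetric_def dest: symD)
  have a0: "a i j \<ge> 0" for i j by (simp add: a_def)
  have "eigenvalue_count (laplacian_mat vs G) {0..<1} \<le> card J"
  proof (rule eigenvalue_count_le_codim[OF laplacian_mat_carrier laplacian_transpose[OF G], where c = 1])
    fix x :: "real vec"
    assume x: "x \<in> carrier_vec ?n" and xJ: "\<forall>j\<in>J. x $ j = 0"
    \<comment> \<open>For j in J the entry x_j is 0, so \<open>b i j\<close> is exactly the term of
      the form for the pair (i, j). A vertex outside D has a neighbour in D, so its row sum reaches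
      x_i^2.\<close>
    define b where "b i j = (if j \<in> J then a i j * (x $ i)\<^sup>2 else 0)" for i j
    have b: "(\<Sum>j<?n. b i j) \<ge> x $ i * x $ i" if i: "i < ?n" for i
    proof (cases "i \<in> J")
      case True
      then have "x $ i * x $ i = 0" using xJ by simp
      then show ?thesis by (simp add: b_def a0 sum_nonneg)
    next
      case False
      then have "vs ! i \<in> pverts G - D" using i d nth_mem[OF i] by (auto simp: J_def)
      then obtain u where u: "u \<in> D" "(vs ! i, u) \<in> parcs G" using D by (auto simp: dominating_def)
      then have "u \<in> set vs" using DV d by blast
      then obtain j where j: "j < ?n" "u = vs ! j" by (auto simp: in_set_conv_nth)
      have "b i j \<le> (\<Sum>j<?n. b i j)"
        using j by (intro member_le_sum) (auto simp: b_def a0)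
      moreover have "b i j = x $ i * x $ i"
        using u j by (simp add: b_def a_def J_def power2_eq_square)
      ultimately show ?thesis by simp
    qed
    have "2 * (x \<bullet> x) = 2 * (\<Sum>i<?n. x $ i * x $ i)"
      using x by (simp add: scalar_prod_def atLeast0LessThan)
    also have "\<dots> \<le> 2 * (\<Sum>i<?n. \<Sum>j<?n. b i j)"
      using b by (intro mult_left_mono sum_mono) auto
    also have "\<dots> = (\<Sum>i<?n. \<Sum>j<?n. b i j) + (\<Sum>i<?n. \<Sum>j<?n. b j i)"
      using sum.swap[of "\<lambda>i j. b j i" "{..<?n}" "{..<?n}"] by simp
    also have "\<dots> = (\<Sum>i<?n. \<Sum>j<?n. b i j + b j i)" by (simp add: sum.distrib)
    also have "\<dots> \<le> (\<Sum>i<?n. \<Sum>j<?n. a i j * (x $ i - x $ j)\<^sup>2)"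
    proof (intro sum_mono)
      fix i j
      \<comment> \<open>Equality holds if exactly one index lies in J; otherwise the left side is 0,
        since x vanishes on J.\<close>
      show "b i j + b j i \<le> a i j * (x $ i - x $ j)\<^sup>2"
        using xJ a0[of i j] by (cases "i \<in> J"; cases "j \<in> J") (auto simp: b_def a_sym[of j i])
    qed
    also have "\<dots> = 2 * (x \<bullet> (laplacian_mat vs G *\<^sub>v x))"
      unfolding laplacian_quadratic_form[OF G vs x] a_def ..
    finally show "1 * (x \<bullet> x) \<le> x \<bullet> (laplacian_mat vs G *\<^sub>v x)" by simp
  qed (auto simp: J_def)
  then show ?thesis by (simp add: laplacian_count_eq[OF vs] cardJ)
qed

theorem theorem5:
  fixes G :: "'a pair_pre_digraph" and n :: nat
  assumes "pair_graph G"
    and "card (pverts G) = n"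
  shows "laplacian_count G {0..<1} * laplacian_count (graph_complement G) {0..<1} \<le> n"
proof -
  interpret pair_graph G by fact
  let ?R = "\<lambda>u v. (u, v) \<in> parcs G"
  have "?R v u" if "?R u v" for u v
    using that pair_sym_arcs by (auto simp: symmetric_def dest: symD)
  then obtain D D' where D: "dominating ?R (pverts G) D"
    and D': "dominating (\<lambda>u v. u \<noteq> v \<and> \<not> ?R u v) (pverts G) D'"
    and le: "card D * card D' \<le> card (pverts G)"
    using jaeger_payan[OF pair_finite_verts, of ?R] by blast
  have "dominating (\<lambda>u v. (u, v) \<in> parcs (graph_complement G)) (pverts (graph_complement G)) D'"
    unfolding dominating_def
  proof (intro conjI ballI)
    show "D' \<subseteq> pverts (graph_complement G)"
      using D' by (simp add: dominating_def graph_complement_def)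
    fix v assume "v \<in> pverts (graph_complement G) - D'"
    then have v: "v \<in> pverts G - D'" by (simp add: graph_complement_def)
    then obtain d where "d \<in> D'" "v \<noteq> d" "\<not> ?R v d" using D' by (auto simp: dominating_def)
    moreover from this have "d \<in> pverts G" using D' by (auto simp: dominating_def)
    ultimately show "\<exists>d\<in>D'. (v, d) \<in> parcs (graph_complement G)"
      using v by (auto simp: graph_complement_def)
  qed
  then have "laplacian_count (graph_complement G) {0..<1} \<le> card D'"
    by (rule laplacian_count_le_dominating[OF pair_graph_complement[OF assms(1)]])
  moreover have "laplacian_count G {0..<1} \<le> card D"
    using laplacian_count_le_dominating[OF assms(1) D] .
  ultimately show ?thesis using le assms(2) by (meson le_trans mult_le_mono)
qed

end
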